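(* Let $\alpha\in\mathbb{C}$ and let $F$ and $G$ be two entire functions that satisfy the functional equations $$F(z)=F(z+\pi)=q\,e^{2i\alpha+4iz}F(z+\pi\tau),$$ $$G(z)=G(z+\pi)=q\,e^{2i\alpha+4iz}G(z+\pi\tau).$$ Then there exists a constant $C$ independent of $x$ and $y$ such that $$\frac{F(x)}{G(x)}-\frac{F(y)}{G(y)}=C\,\frac{\theta_1(x+y+\alpha|\tau)\,\theta_1(x-y|\tau)}{G(x)G(y)}$$ for all $x,y\in\mathbb{C}$ with $G(x)G(y)\neq0$.
   Context: Fix $\tau\in\mathbb{C}$ with $\mathrm{Im}\,\tau>0$ and put $q=e^{2\pi i\tau}$, with $q^{s}=e^{2\pi i s\tau}$. The Jacobi theta function is the entire function $\theta_1(z|\tau)=2\sum_{n=0}^\infty(-1)^n q^{(2n+1)^2/8}\sin((2n+1)z)$. *)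

theory Defs
  imports "HOL-Complex_Analysis.Complex_Analysis"
begin

text \<open>
  \<open>qpow \<tau> s\<close> is $q^s$, where $q = e^{2\pi i\tau}$; the parameter \<open>\<tau>\<close> fixes the branch, so this is
  not the principal power \<open>q powr s\<close>.
\<close>
definition qpow :: "complex \<Rightarrow> complex \<Rightarrow> complex" where
  "qpow \<tau> s = exp (2 * of_real pi * \<i> * s * \<tau>)"

text \<open>The series converges (for every \<open>z\<close>) when \<open>Im \<tau> > 0\<close>; otherwise the value is irrelevant.\<close>
definition jacobi_theta1 :: "complex \<Rightarrow> complex \<Rightarrow> complex" where
  "jacobi_theta1 z \<tau> =
     2 * (\<Sum>n. (-1) ^ n * qpow \<tau> ((2 * of_nat n + 1)\<^sup>2 / 8) * sin ((2 * of_nat n + 1) * z))"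

end

theory Submission
  imports Defs "HOL-Real_Asymp.Real_Asymp"
begin

text \<open>
  The functional equations say that $F$ and $G$ lie in the space $V$ of $\pi$-periodic entire
  functions with $f(z) = \kappa e^{4iz} f(z + \pi\tau)$, $\kappa = q e^{2i\alpha}$. The second
  equation relates the Fourier coefficients $a_n$ and $a_{n-2}$, so an element of $V$ is determined
  by $a_0$ and $a_1$, and $\dim V \le 2$. Put $D(x,y) = F(x)G(y) - F(y)G(x)$ and
  $T(x,y) = \theta_1(x+y+\alpha)\theta_1(x-y)$. Both are antisymmetric, and $T(\cdot,z) \in V$, so
  the linear dependence of $F$, $G$ and $T(\cdot,z)$ together with $T(z,z) = 0$ gives
  $D(x,z)\,T(y,z) = D(y,z)\,T(x,z)$. Since $T$ is not identically zero, $D$ is a constant multiple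
  of $T$.
\<close>

section \<open>Quotients of entire functions\<close>

text \<open>\<open>f\<close> vanishes on the nonempty open set where \<open>g\<close> does not, so
  the identity theorem applies. This cancels factors that have zeros but are not identically
  zero.\<close>

lemma entire_mult_eq_0:
  fixes f g :: "complex \<Rightarrow> complex"
  assumes f: "f holomorphic_on UNIV" and g: "g holomorphic_on UNIV"
    and fg: "\<And>z. f z * g z = 0" and p: "g p \<noteq> 0"
  shows "f z = 0"
proof -
  define S where "S = {w. g w \<noteq> 0}"
  have "open S"
    unfolding S_def by (intro open_Collect_neq continuous_on_const holomorphic_on_imp_continuous_on[OF g])
  moreover have "f w = 0" if "w \<in> S" for w
    using fg[of w] that by (simp add: S_def)
  ultimately show ?thesis
    using analytic_continuation_open[of S UNIV f "\<lambda>_. 0" z] f p by (force simp: S_def)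
qed

text \<open>All zeros of \<open>u\<close> are simple and are zeros of \<open>f\<close>, so the
  singularities of \<open>f z / u z\<close> are removable. L'Hopital's rule gives the value there,
  and this is the value built into \<open>g\<close>.\<close>

lemma entire_quotient:
  fixes f u :: "complex \<Rightarrow> complex"
  assumes f: "f holomorphic_on UNIV" and u: "u holomorphic_on UNIV"
    and zero: "\<And>a. u a = 0 \<Longrightarrow> f a = 0 \<and> deriv u a \<noteq> 0"
  obtains g where "g holomorphic_on UNIV" "\<And>z. f z = g z * u z"
proof -
  define g where "g z = (if u z = 0 then deriv f z / deriv u z else f z / u z)" for z
  have df: "(f has_field_derivative deriv f z) (at z)" and du: "(u has_field_derivative deriv u z) (at z)" for z
    using f u by (auto intro: holomorphic_derivI)
  have open_nz: "open {z. u z \<noteq> 0}"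
    by (intro open_Collect_neq continuous_on_const holomorphic_on_imp_continuous_on[OF u])
  have hol: "g holomorphic_on A" if "A \<subseteq> {z. u z \<noteq> 0}" for A
  proof -
    have "(\<lambda>z. f z / u z) holomorphic_on A"
      using that by (intro holomorphic_intros holomorphic_on_subset[OF f] holomorphic_on_subset[OF u]) auto
    then show ?thesis
      by (rule holomorphic_transform) (use that in \<open>auto simp: g_def\<close>)
  qed
  have "g field_differentiable at a" for a
  proof (cases "u a = 0")
    case False
    then show ?thesis
      using hol[OF subset_refl] open_nz by (auto simp: holomorphic_on_open field_differentiable_def)
  next
    case True
    then have fa: "f a = 0" and ua: "deriv u a \<noteq> 0" using zero by auto
    \<comment> \<open>Isolation of the zero \<open>a\<close> requires that \<open>u\<close> is not
      identically zero; otherwise its derivative at \<open>a\<close> would vanish.\<close>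
    have "\<exists>p. u p \<noteq> 0"
    proof (rule ccontr)
      assume "\<not> ?thesis"
      then have "u = (\<lambda>_. 0)" by auto
      then show False using ua by simp
    qed
    then obtain p where p: "u p \<noteq> 0" ..
    obtain r where r: "0 < r" "\<And>w. w \<in> ball a r - {a} \<Longrightarrow> u w \<noteq> 0"
      using isolated_zeros[OF u open_UNIV connected_UNIV UNIV_I True UNIV_I p] by metis
    have ev: "\<forall>\<^sub>F w in at a. f w / u w = g w"
      using r by (auto simp: eventually_at g_def dist_commute intro!: exI[of _ r])
    have "((\<lambda>w. f w / u w) \<longlongrightarrow> g a) (at a)"
      by (rule lhopital_complex_simple[OF df du]) (use fa True ua in \<open>auto simp: g_def\<close>)
    then have lim: "(g \<longlongrightarrow> g a) (at a)"
      by (rule Lim_transform_eventually) (rule ev)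
    have holb: "g holomorphic_on ball a r - {a}"
      using r(2) by (intro hol) auto
    have "continuous (at w) g" if "w \<in> ball a r" for w
    proof (cases "w = a")
      case True
      then show ?thesis using lim by (simp add: continuous_at)
    next
      case False
      have "isCont g w"
        using holomorphic_on_imp_continuous_on[OF holb] that False
        by (subst (asm) continuous_on_eq_continuous_at) (auto simp: open_delete)
      then show ?thesis .
    qed
    then have "continuous_on (ball a r) g"
      by (simp add: continuous_at_imp_continuous_on)
    then have "g holomorphic_on ball a r"
      by (rule no_isolated_singularity[where K = "{a}"]) (use holb in auto)
    then show ?thesis
      using r(1) by (auto simp: holomorphic_on_open field_differentiable_def)
  qed
  then have "g holomorphic_on UNIV"
    by (simp add: holomorphic_on_def)
  moreover have "f z = g z * u z" for z
    using zero by (auto simp: g_def)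
  ultimately show ?thesis by (rule that)
qed

section \<open>Fourier coefficients of periodic entire functions\<close>

lemma entire_integrable_linepath:
  "f holomorphic_on UNIV \<Longrightarrow> f contour_integrable_on linepath a b"
  by (meson contour_integrable_continuous_linepath holomorphic_on_imp_continuous_on holomorphic_on_subset subset_UNIV)

text \<open>For an entire primitive \<open>H\<close> of \<open>h\<close>, the function
  \<open>H (z + p) - H z\<close> has derivative \<open>h (z + p) - h z = 0\<close> and is therefore
  constant.\<close>

lemma contour_integral_period_shift:
  fixes h :: "complex \<Rightarrow> complex"
  assumes h: "h holomorphic_on UNIV" and per: "\<And>z. h (z + p) = h z"
  shows "contour_integral (linepath a (a + p)) h = contour_integral (linepath b (b + p)) h"
proof -
  obtain H where H: "\<And>z. (H has_field_derivative h z) (at z)"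
    using holomorphic_convex_primitive[of UNIV "{}" h] h holomorphic_on_imp_continuous_on[OF h]
    by (auto simp: holomorphic_on_def)
  have int: "contour_integral (linepath c (c + p)) h = H (c + p) - H c" for c
    using contour_integral_primitive[of UNIV H h "linepath c (c + p)"] H
    by (auto intro: contour_integral_unique)
  have "((\<lambda>z. H (z + p) - H z) has_field_derivative 0) (at z)" for z
    using DERIV_diff[OF DERIV_shift[THEN iffD1, OF H[of "z + p"]] H[of z]] per by simp
  then have "\<exists>c. \<forall>z\<in>UNIV. H (z + p) - H z = c"
    by (intro has_field_derivative_zero_constant) auto
  then show ?thesis by (auto simp: int)
qed

lemma contour_integral_translate:
  "contour_integral (linepath a b) (\<lambda>z. h (z + c)) = contour_integral (linepath (a + c) (b + c)) h"
proof -
  have "linepath (a + c) (b + c) x = linepath a b x + c" for x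
    by (simp add: linepath_def algebra_simps scaleR_conv_of_real)
  then show ?thesis by (simp add: contour_integral_integral)
qed

text \<open>The coefficient of a function of period pi, without the normalising factor 1/pi. A
  contour integral is used so that the segment can later be moved off the real axis.\<close>

definition fourier_coeff :: "int \<Rightarrow> (complex \<Rightarrow> complex) \<Rightarrow> complex" where
  "fourier_coeff n f = contour_integral (linepath 0 (of_real pi)) (\<lambda>z. f z * exp (- (2 * of_int n * \<i> * z)))"

lemma exp_pi_period: "exp (- (2 * of_int n * \<i> * (z + of_real pi))) = exp (- (2 * of_int n * \<i> * z))"
proof -
  have "exp (- (2 * of_int n * \<i> * (z + of_real pi))) = 
      exp (- (2 * of_int n * \<i> * z)) * exp (2 * of_int (-n) * of_real pi * \<i>)"
    by (simp flip: exp_add add: algebra_simps)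
  also have "exp (2 * of_int (-n) * of_real pi * \<i>) = 1"
    using exp_integer_2pi[of "of_int (-n)"] by (simp add: mult_ac)
  finally show ?thesis by simp
qed

lemma fourier_coeff_shift:
  assumes f: "f holomorphic_on UNIV" and per: "\<And>z. f (z + of_real pi) = f z"
  shows "fourier_coeff n f =
    contour_integral (linepath a (a + of_real pi)) (\<lambda>z. f z * exp (- (2 * of_int n * \<i> * z)))"
  unfolding fourier_coeff_def
  by (subst contour_integral_period_shift[of _ "of_real pi" a 0])
     (auto intro!: holomorphic_intros f simp: per exp_pi_period)

lemma fourier_coeff_add:
  assumes "f holomorphic_on UNIV" "g holomorphic_on UNIV"
  shows "fourier_coeff n (\<lambda>z. f z + g z) = fourier_coeff n f + fourier_coeff n g"
  unfolding fourier_coeff_def ring_distribs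
  by (intro contour_integral_add entire_integrable_linepath holomorphic_intros assms)

lemma fourier_coeff_cmult:
  assumes "f holomorphic_on UNIV"
  shows "fourier_coeff n (\<lambda>z. c * f z) = c * fourier_coeff n f"
  unfolding fourier_coeff_def mult.assoc
  by (intro contour_integral_lmul entire_integrable_linepath holomorphic_intros assms)

lemma fourier_coeff_exp:
  "fourier_coeff n (\<lambda>z. exp (2 * of_int m * \<i> * z)) = (if n = m then of_real pi else 0)"
proof -
  define k where "k = m - n"
  have eq: "exp (2 * of_int m * \<i> * z) * exp (- (2 * of_int n * \<i> * z)) = exp (- (2 * of_int (-k) * \<i> * z))" for z
    by (simp flip: exp_add add: k_def algebra_simps)
  show ?thesis
  proof (cases "k = 0")
    case True
    then show ?thesis unfolding fourier_coeff_def eq by (simp add: k_def)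
  next
    case False
    define H where "H z = exp (- (2 * of_int (-k) * \<i> * z)) / (2 * of_int k * \<i>)" for z
    have "(H has_field_derivative exp (- (2 * of_int (-k) * \<i> * z))) (at z)" for z
      unfolding H_def using False by (auto intro!: derivative_eq_intros simp: field_simps)
    then have "contour_integral (linepath 0 (of_real pi)) (\<lambda>z. exp (- (2 * of_int (-k) * \<i> * z))) = H (of_real pi) - H 0"
      using contour_integral_primitive[of UNIV H _ "linepath 0 (of_real pi)"]
      by (intro contour_integral_unique) (simp del: linepath_0)
    also have "H (of_real pi) = H 0"
      using exp_pi_period[of "-k" 0] by (simp add: H_def)
    finally show ?thesis using False unfolding fourier_coeff_def eq by (simp add: k_def del: linepath_0)
  qed
qed

text \<open>Move the segment to the height \<open>Im z = s\<close>: the exponential has modulus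
  \<open>exp (2 * of_int n * s)\<close> there and \<open>f\<close> is bounded by compactness.
  \<open>B\<close> may depend on \<open>s\<close> but not on \<open>n\<close>, and \<open>s\<close>
  may have either sign.\<close>

lemma fourier_coeff_bound:
  assumes f: "f holomorphic_on UNIV" and per: "\<And>z. f (z + of_real pi) = f z"
  obtains B where "\<And>n. norm (fourier_coeff n f) \<le> B * exp (2 * of_int n * s)"
proof -
  define a where "a = \<i> * of_real s"
  have "compact (f ` closed_segment a (a + of_real pi))"
    by (intro compact_continuous_image holomorphic_on_imp_continuous_on holomorphic_on_subset[OF f]) auto
  then obtain C where C: "C > 0" "\<And>z. z \<in> closed_segment a (a + of_real pi) \<Longrightarrow> norm (f z) \<le> C"
    using compact_imp_bounded bounded_pos by (metis imageI)
  have "norm (fourier_coeff n f) \<le> (C * pi) * exp (2 * of_int n * s)" for n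
  proof -
    have "norm (fourier_coeff n f) \<le> (C * exp (2 * of_int n * s)) * norm ((a + of_real pi) - a)"
      unfolding fourier_coeff_shift[OF f per, of n a]
    proof (rule contour_integral_bound_linepath)
      fix z assume z: "z \<in> closed_segment a (a + of_real pi)"
      then have "Im z = s" by (auto simp: closed_segment_def a_def algebra_simps)
      then have "norm (exp (- (2 * of_int n * \<i> * z))) = exp (2 * of_int n * s)"
        unfolding norm_exp_eq_Re by simp
      then show "norm (f z * exp (- (2 * of_int n * \<i> * z))) \<le> C * exp (2 * of_int n * s)"
        unfolding norm_mult by (metis C(2)[OF z] exp_ge_zero mult_right_mono)
    qed (use C in \<open>auto intro!: entire_integrable_linepath holomorphic_intros f\<close>)
    then show ?thesis by (simp add: mult_ac)
  qed
  then show ?thesis by (rule that)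
qed

lemma deriv_exp_linear_minus_1: "deriv (\<lambda>z. exp (c * (z - z0)) - 1) a = c * exp (c * (a - z0))" for c :: complex
  by (rule DERIV_imp_deriv) (auto intro!: derivative_eq_intros)

lemma geometric_bound_imp_0:
  assumes "\<And>k::nat. norm (x::complex) \<le> B * exp (- (2 * real k))"
  shows "x = 0"
proof -
  have "(\<lambda>k::nat. B * exp (- (2 * real k))) \<longlonglongrightarrow> 0"
    by real_asymp
  then have "norm x \<le> 0"
    by (rule LIMSEQ_le_const) (use assms in auto)
  then show ?thesis by simp
qed

text \<open>Chernoff's argument: if $f - f(z_0) = g \cdot (e^{2i(z-z_0)} - 1)$ with $g$ entire and
  periodic, the coefficients of $g$ form a geometric sequence on each side of the index $0$, with a
  jump proportional to $f(z_0)$ there. Moving the segment of integration up or down shows that both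
  sequences decay too fast to be nonzero.\<close>
lemma fourier_coeff_zero_imp_zero:
  assumes f: "f holomorphic_on UNIV" and per: "\<And>z. f (z + of_real pi) = f z"
    and zero: "\<And>n. fourier_coeff n f = 0"
  shows "f z0 = 0"
proof -
  define u where "u z = exp (2 * \<i> * (z - z0)) - 1" for z
  have u: "u holomorphic_on UNIV" unfolding u_def by (intro holomorphic_intros)
  have u_per: "u (z + of_real pi) = u z" for z
    using exp_pi_period[of "-1" "z - z0"] by (simp add: u_def algebra_simps)
  \<comment> \<open>The zeros of \<open>u\<close> are the translates of \<open>z0\<close> by integer
    multiples of pi, where \<open>f\<close> takes the value \<open>f z0\<close> by
    periodicity.\<close>
  have zeros: "f a - f z0 = 0 \<and> deriv u a \<noteq> 0" if ua: "u a = 0" for a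
  proof
    have "exp (2 * \<i> * (a - z0)) = 1" using ua by (simp add: u_def)
    then obtain n :: int where "2 * \<i> * (a - z0) = of_int (2 * n) * of_real pi * \<i>"
      using exp_eq[of "2 * \<i> * (a - z0)" 0] by auto
    then have a: "a = z0 + of_int n * of_real pi" by (simp add: algebra_simps complex_eq_iff)
    have pos: "f (z + of_nat k * of_real pi) = f z" for z and k :: nat
    proof (induction k)
      case (Suc k)
      then show ?case using per[of "z + of_nat k * of_real pi"] by (simp add: algebra_simps)
    qed simp
    have "f (z0 + of_int n * of_real pi) = f z0"
      using pos[of z0 "nat n"] pos[of "z0 + of_int n * of_real pi" "nat (-n)"]
      by (cases "n \<ge> 0") (auto simp: algebra_simps)
    then show "f a - f z0 = 0" by (simp add: a)
    show "deriv u a \<noteq> 0" unfolding u_def deriv_exp_linear_minus_1 by simp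
  qed
  then obtain g where g: "g holomorphic_on UNIV" and fg: "\<And>z. f z - f z0 = g z * u z"
    using entire_quotient[of "\<lambda>z. f z - f z0" u, OF _ u zeros]
      holomorphic_on_diff[OF f holomorphic_on_const[of "f z0"]] by blast
  \<comment> \<open>Here \<open>u\<close> equals -2; this point witnesses that \<open>u\<close> can
    be cancelled when the periodicity of \<open>g\<close> is derived.\<close>
  have up: "u (z0 + of_real pi / 2) \<noteq> 0"
    by (simp add: u_def mult.commute[of \<i>])
  have g_per: "g (z + of_real pi) = g z" for z
  proof -
    have "(\<lambda>z. g (z + of_real pi)) holomorphic_on UNIV"
      by (rule holomorphic_on_compose[of "\<lambda>z. z + of_real pi" UNIV g, unfolded o_def])
         (auto intro!: holomorphic_intros holomorphic_on_subset[OF g])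
    moreover have "(g (w + of_real pi) - g w) * u w = 0" for w
      using fg[of w] fg[of "w + of_real pi"] per[of w] u_per[of w] by (auto simp: algebra_simps)
    ultimately have "g (z + of_real pi) - g z = 0"
      by (intro entire_mult_eq_0[of "\<lambda>z. g (z + of_real pi) - g z" u "z0 + of_real pi / 2" z]
          holomorphic_on_diff g u up)
    then show ?thesis by simp
  qed
  define e where "e = exp (- (2 * \<i> * z0))"
  have shift: "fourier_coeff n (\<lambda>z. g z * exp (2 * \<i> * z)) = fourier_coeff (n - 1) g" for n
  proof -
    have "exp (2 * \<i> * z) * exp (- (2 * of_int n * \<i> * z)) = exp (- (2 * of_int (n - 1) * \<i> * z))" for z :: complex
      by (simp flip: exp_add add: algebra_simps)
    then show ?thesis by (simp add: fourier_coeff_def mult.assoc)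
  qed
  \<comment> \<open>Solve the factorisation for \<open>g\<close>: it equals
    \<open>f z0 - f z + e * (g z * exp (2 * \<i> * z))\<close>. The constant contributes only at
    index 0, \<open>f\<close> contributes nothing, and the exponential shifts the index by
    one.\<close>
  have rec: "fourier_coeff n g = (if n = 0 then of_real pi * f z0 else 0) + e * fourier_coeff (n - 1) g" for n
  proof -
    have "g z = f z0 * exp (2 * of_int 0 * \<i> * z) + ((-1) * f z + e * (g z * exp (2 * \<i> * z)))" for z
      using fg[of z] by (simp add: u_def e_def algebra_simps flip: exp_add)
    then have "fourier_coeff n g = fourier_coeff n (\<lambda>z. f z0 * exp (2 * of_int 0 * \<i> * z) + ((-1) * f z + e * (g z * exp (2 * \<i> * z))))"
      by (simp add: fourier_coeff_def)
    also have "\<dots> = f z0 * fourier_coeff n (\<lambda>z. exp (2 * of_int 0 * \<i> * z)) + ((-1) * fourier_coeff n f + e * fourier_coeff (n - 1) g)"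
      by (simp only: fourier_coeff_add fourier_coeff_cmult shift holomorphic_intros f g)
    finally show ?thesis
      by (simp add: zero fourier_coeff_exp del: of_int_0)
  qed
  \<comment> \<open>The geometric ratio \<open>e\<close> has modulus \<open>exp (2 * Im z0)\<close>.
    One unit below \<open>Im z0\<close> the bound gains \<open>exp (- (2 * real k))\<close> at index
    \<open>k\<close>; one unit above, it gains the same at the negative indices.\<close>
  obtain B1 where B1: "\<And>n. norm (fourier_coeff n g) \<le> B1 * exp (2 * of_int n * (Im z0 - 1))"
    using fourier_coeff_bound[OF g g_per] by metis
  obtain B2 where B2: "\<And>n. norm (fourier_coeff n g) \<le> B2 * exp (2 * of_int n * (Im z0 + 1))"
    using fourier_coeff_bound[OF g g_per] by metis
  have norm_e: "norm e = exp (2 * Im z0)" by (simp add: e_def)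
  have pos: "fourier_coeff (int k) g = e ^ k * fourier_coeff 0 g" for k
  proof (induction k)
    case (Suc k)
    then show ?case using rec[of "int (Suc k)"] by simp
  qed simp
  have "norm (fourier_coeff 0 g) \<le> B1 * exp (- (2 * real k))" for k
  proof -
    have "exp (2 * real k * Im z0) * norm (fourier_coeff 0 g) \<le> B1 * exp (2 * real k * (Im z0 - 1))"
      using B1[of "int k"] by (simp add: pos norm_mult norm_power norm_e flip: exp_of_nat_mult) (simp add: mult_ac)
    also have "\<dots> = exp (2 * real k * Im z0) * (B1 * exp (- (2 * real k)))"
      by (simp flip: exp_add add: algebra_simps)
    finally show ?thesis by simp
  qed
  then have z: "fourier_coeff 0 g = 0" by (rule geometric_bound_imp_0)
  \<comment> \<open>The downward recursion starts at -1, since the step from -1 to 0 carries the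
    jump.\<close>
  have neg: "fourier_coeff (-1) g = e ^ k * fourier_coeff (-1 - int k) g" for k
  proof (induction k)
    case (Suc k)
    then show ?case using rec[of "-1 - int k"] by (simp add: algebra_simps)
  qed simp
  have "norm (fourier_coeff (-1) g) \<le> (B2 * exp (-2 * (Im z0 + 1))) * exp (- (2 * real k))" for k
  proof -
    have "norm (fourier_coeff (-1) g) = exp (2 * real k * Im z0) * norm (fourier_coeff (-1 - int k) g)"
      by (subst neg[of k]) (simp add: norm_mult norm_power norm_e mult_ac flip: exp_of_nat_mult)
    also have "\<dots> \<le> exp (2 * real k * Im z0) * (B2 * exp (2 * of_int (-1 - int k) * (Im z0 + 1)))"
      by (intro mult_left_mono B2) auto
    also have "\<dots> = (B2 * exp (-2 * (Im z0 + 1))) * exp (- (2 * real k))"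
      by (simp flip: exp_add add: algebra_simps)
    finally show ?thesis .
  qed
  then have "fourier_coeff (-1) g = 0" by (rule geometric_bound_imp_0)
  \<comment> \<open>With both neighbouring coefficients zero, the jump
    \<open>of_real pi * f z0\<close> must vanish.\<close>
  then show ?thesis using rec[of 0] z by simp
qed

section \<open>A space of quasi-periodic functions of dimension at most two\<close>

text \<open>Theta functions of order two; \<open>\<kappa>\<close> is left arbitrary so that the
  linear algebra does not depend on the particular multiplier.\<close>

definition theta_space :: "complex \<Rightarrow> complex \<Rightarrow> (complex \<Rightarrow> complex) set" where
  "theta_space \<kappa> \<tau> = {f. f holomorphic_on UNIV \<and> (\<forall>z. f (z + of_real pi) = f z) \<and>
     (\<forall>z. f z = \<kappa> * exp (4 * \<i> * z) * f (z + of_real pi * \<tau>))}"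

lemma theta_space_holomorphic: "f \<in> theta_space \<kappa> \<tau> \<Longrightarrow> f holomorphic_on UNIV"
  unfolding theta_space_def by blast

lemma theta_space_period: "f \<in> theta_space \<kappa> \<tau> \<Longrightarrow> f (z + of_real pi) = f z"
  unfolding theta_space_def by blast

lemma theta_space_quasi_period:
  "f \<in> theta_space \<kappa> \<tau> \<Longrightarrow> f z = \<kappa> * exp (4 * \<i> * z) * f (z + of_real pi * \<tau>)"
  unfolding theta_space_def by blast

lemma theta_space_add:
  assumes "f \<in> theta_space \<kappa> \<tau>" "g \<in> theta_space \<kappa> \<tau>"
  shows "(\<lambda>z. f z + g z) \<in> theta_space \<kappa> \<tau>"
  unfolding theta_space_def mem_Collect_eq
proof (intro conjI allI)
  show "f z + g z = \<kappa> * exp (4 * \<i> * z) * (f (z + of_real pi * \<tau>) + g (z + of_real pi * \<tau>))" for z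
    unfolding ring_distribs using assms[THEN theta_space_quasi_period, of z] by simp
  show "(\<lambda>z. f z + g z) holomorphic_on UNIV"
    by (intro holomorphic_on_add assms[THEN theta_space_holomorphic])
  show "f (z + of_real pi) + g (z + of_real pi) = f z + g z" for z
    using assms[THEN theta_space_period, of z] by (simp only:)
qed

lemma theta_space_cmult:
  assumes "f \<in> theta_space \<kappa> \<tau>"
  shows "(\<lambda>z. c * f z) \<in> theta_space \<kappa> \<tau>"
  unfolding theta_space_def mem_Collect_eq
proof (intro conjI allI)
  show "c * f z = \<kappa> * exp (4 * \<i> * z) * (c * f (z + of_real pi * \<tau>))" for z
    using assms[THEN theta_space_quasi_period, of z] by (simp add: mult_ac)
  show "(\<lambda>z. c * f z) holomorphic_on UNIV"
    by (intro holomorphic_on_mult holomorphic_on_const theta_space_holomorphic[OF assms])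
  show "c * f (z + of_real pi) = c * f z" for z
    using theta_space_period[OF assms, of z] by (simp only:)
qed

text \<open>The factor \<open>exp (4 * \<i> * z)\<close> lowers the index by two. The translation by
  \<open>of_real pi * \<tau>\<close> moves the segment of integration, which periodicity allows to
  be moved back.\<close>

lemma fourier_coeff_theta_space_rec:
  assumes f: "f \<in> theta_space \<kappa> \<tau>"
  shows "fourier_coeff n f =
    \<kappa> * exp (2 * of_int (n - 2) * \<i> * (of_real pi * \<tau>)) * fourier_coeff (n - 2) f"
proof -
  define c where "c = of_real pi * \<tau>"
  define h where "h z = f z * exp (- (2 * of_int (n - 2) * \<i> * z))" for z
  have h: "h holomorphic_on UNIV"
    unfolding h_def by (intro holomorphic_intros theta_space_holomorphic[OF f])
  have hc: "(\<lambda>z. h (z + c)) holomorphic_on UNIV"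
    by (rule holomorphic_on_compose[of "\<lambda>z. z + c" UNIV h, unfolded o_def])
       (auto intro!: holomorphic_intros holomorphic_on_subset[OF h])
  have "f z * exp (- (2 * of_int n * \<i> * z)) = \<kappa> * exp (2 * of_int (n - 2) * \<i> * c) * h (z + c)" for z
  proof -
    have "exp (4 * \<i> * z) * exp (- (2 * of_int n * \<i> * z)) =
        exp (2 * of_int (n - 2) * \<i> * c) * exp (- (2 * of_int (n - 2) * \<i> * (z + c)))"
      by (simp flip: exp_add add: algebra_simps)
    then show ?thesis
      by (subst theta_space_quasi_period[OF f]) (simp add: h_def c_def mult_ac)
  qed
  then have "fourier_coeff n f = 
      \<kappa> * exp (2 * of_int (n - 2) * \<i> * c) * contour_integral (linepath 0 (of_real pi)) (\<lambda>z. h (z + c))"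
    unfolding fourier_coeff_def
    by (simp only: contour_integral_lmul entire_integrable_linepath hc)
  also have "contour_integral (linepath 0 (of_real pi)) (\<lambda>z. h (z + c)) = 
      contour_integral (linepath c (c + of_real pi)) h"
    using contour_integral_translate[of 0 "of_real pi" h c] by (simp add: add.commute)
  also have "\<dots> = fourier_coeff (n - 2) f"
    unfolding h_def
    by (rule fourier_coeff_shift[symmetric]) (rule theta_space_holomorphic[OF f] theta_space_period[OF f])+
  finally show ?thesis by (simp add: c_def)
qed

lemma theta_space_zero:
  assumes f: "f \<in> theta_space \<kappa> \<tau>" and "\<kappa> \<noteq> 0"
    and "fourier_coeff 0 f = 0" "fourier_coeff 1 f = 0"
  shows "f z = 0"
proof (rule fourier_coeff_zero_imp_zero[of f])
  show "f holomorphic_on UNIV"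
    using f by (rule theta_space_holomorphic)
  show "f (z + of_real pi) = f z" for z
    using f by (rule theta_space_period)
  fix n
  \<comment> \<open>The recursion has step two, so the induction carries a pair of adjacent
    coefficients. The downward direction divides by \<open>\<kappa>\<close>.\<close>
  have "fourier_coeff n f = 0 \<and> fourier_coeff (n + 1) f = 0"
  proof (induction n rule: int_induct[where k = 0])
    case (step1 i)
    then show ?case using fourier_coeff_theta_space_rec[OF f, of "i + 2"] by (simp add: add.assoc)
  next
    case (step2 i)
    then show ?case using fourier_coeff_theta_space_rec[OF f, of "i + 1"] \<open>\<kappa> \<noteq> 0\<close> by simp
  qed (use assms in auto)
  then show "fourier_coeff n f = 0" ..
qed

text \<open>Three elements of the at most two-dimensional space \<open>theta_space \<kappa> \<tau>\<close> are linearly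
  dependent, so the determinant of their values at any three points vanishes.\<close>
lemma theta_space_det_zero:
  assumes f: "f \<in> theta_space \<kappa> \<tau>" and g: "g \<in> theta_space \<kappa> \<tau>" and h: "h \<in> theta_space \<kappa> \<tau>"
    and \<kappa>: "\<kappa> \<noteq> 0"
  shows "(f x * g y - f y * g x) * h z + (f y * g z - f z * g y) * h x + (f z * g x - f x * g z) * h y = 0"
proof -
  note hol = f[THEN theta_space_holomorphic] g[THEN theta_space_holomorphic] h[THEN theta_space_holomorphic]
  note coeff = fourier_coeff_add fourier_coeff_cmult holomorphic_on_add holomorphic_on_mult holomorphic_on_const hol
  \<comment> \<open>The 2 x 2 minor formed from the coefficients 0 and 1 of two functions.\<close>
  define c where "c p r = fourier_coeff 0 p * fourier_coeff 1 r - fourier_coeff 1 p * fourier_coeff 0 r" for p r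
  have lin: "fourier_coeff n (\<lambda>w. c f g * h w + (c g h * f w + c h f * g w)) =
      c f g * fourier_coeff n h + (c g h * fourier_coeff n f + c h f * fourier_coeff n g)" for n
    by (simp only: coeff)
  \<comment> \<open>Coefficients 0 and 1 of this combination are 3 x 3 determinants with a repeated
    row of coefficients, hence zero; \<open>theta_space_zero\<close> then annihilates the whole
    function.\<close>
  have comb: "c f g * h w + (c g h * f w + c h f * g w) = 0" for w
  proof (rule theta_space_zero[where f = "\<lambda>w. c f g * h w + (c g h * f w + c h f * g w)"])
    show "(\<lambda>w. c f g * h w + (c g h * f w + c h f * g w)) \<in> theta_space \<kappa> \<tau>"
      by (intro theta_space_add theta_space_cmult f g h)
    show "fourier_coeff 0 (\<lambda>w. c f g * h w + (c g h * f w + c h f * g w)) = 0"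
      "fourier_coeff 1 (\<lambda>w. c f g * h w + (c g h * f w + c h f * g w)) = 0"
      unfolding lin unfolding c_def by algebra+
  qed (rule \<kappa>)
  show ?thesis
  proof (cases "c f g = 0")
    case False
    \<comment> \<open>Eliminate \<open>h\<close> through \<open>comb\<close> at the three points;
      the terms in \<open>f\<close> and \<open>g\<close> left over form determinants with a repeated
      column and cancel.\<close>
    have "c f g * ((f x * g y - f y * g x) * h z + (f y * g z - f z * g y) * h x + (f z * g x - f x * g z) * h y) = 0" (is "?L = 0")
    proof -
      have "?L = (f x * g y - f y * g x) * (c f g * h z + (c g h * f z + c h f * g z)) +
          (f y * g z - f z * g y) * (c f g * h x + (c g h * f x + c h f * g x)) +
          (f z * g x - f x * g z) * (c f g * h y + (c g h * f y + c h f * g y))"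
        by (simp add: algebra_simps)
      then show ?thesis by (simp only: comb) simp
    qed
    then show ?thesis using False by simp
  next
    case True
    then have fg: "fourier_coeff 0 f * fourier_coeff 1 g = fourier_coeff 1 f * fourier_coeff 0 g"
      by (simp add: c_def)
    \<comment> \<open>The coefficient pairs of \<open>f\<close> and \<open>g\<close> are now
      proportional, so the functions are too, and every minor of their values vanishes.\<close>
    have "f v * g w - f w * g v = 0" for v w
    proof -
      have e: "fourier_coeff i g * f w + (- fourier_coeff i f) * g w = 0" if i: "i = 0 \<or> i = 1" for w i
      proof (rule theta_space_zero[where f = "\<lambda>w. fourier_coeff i g * f w + (- fourier_coeff i f) * g w"])
        show "(\<lambda>w. fourier_coeff i g * f w + (- fourier_coeff i f) * g w) \<in> theta_space \<kappa> \<tau>"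
          by (intro theta_space_add theta_space_cmult f g)
        have lin: "fourier_coeff n (\<lambda>w. fourier_coeff i g * f w + (- fourier_coeff i f) * g w) =
            fourier_coeff i g * fourier_coeff n f + (- fourier_coeff i f) * fourier_coeff n g" for n
          by (simp only: coeff)
        show "fourier_coeff 0 (\<lambda>w. fourier_coeff i g * f w + (- fourier_coeff i f) * g w) = 0"
          unfolding lin using i fg by (auto simp: mult.commute)
        show "fourier_coeff 1 (\<lambda>w. fourier_coeff i g * f w + (- fourier_coeff i f) * g w) = 0"
          unfolding lin using i fg by (auto simp: mult.commute)
      qed (rule \<kappa>)
      show ?thesis
      proof (cases "fourier_coeff 0 f = 0 \<and> fourier_coeff 1 f = 0")
        case True
        then have "f w = 0" for w
          by (intro theta_space_zero[OF f \<kappa>]) auto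
        then show ?thesis by simp
      next
        case False
        then obtain i where i: "i = 0 \<or> i = 1" "fourier_coeff i f \<noteq> 0" by blast
        have "fourier_coeff i f * (f v * g w - f w * g v) = 0"
          using e[OF i(1), of v] e[OF i(1), of w] by algebra
        then show ?thesis using i(2) by simp
      qed
    qed
    then show ?thesis by simp
  qed
qed

section \<open>The Jacobi theta function\<close>

definition theta1_term :: "complex \<Rightarrow> nat \<Rightarrow> complex \<Rightarrow> complex" where
  "theta1_term \<tau> n z = (-1) ^ n * qpow \<tau> ((2 * of_nat n + 1)\<^sup>2 / 8) * sin ((2 * of_nat n + 1) * z)"

lemma jacobi_theta1_eq_suminf: "jacobi_theta1 z \<tau> = 2 * (\<Sum>n. theta1_term \<tau> n z)"
  by (simp add: jacobi_theta1_def theta1_term_def)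

section \<open>Convergence and holomorphy of the theta series\<close>

lemma norm_sin_le_exp: "norm (sin (z :: complex)) \<le> exp \<bar>Im z\<bar>"
proof -
  have "norm (sin z) = norm (exp (\<i> * z) - exp (- (\<i> * z))) / 2"
    by (simp add: sin_exp_eq norm_divide norm_mult)
  also have "\<dots> \<le> (norm (exp (\<i> * z)) + norm (exp (- (\<i> * z)))) / 2"
    by (intro divide_right_mono norm_triangle_ineq4) auto
  also have "\<dots> = (exp (- Im z) + exp (Im z)) / 2"
    by simp
  also have "\<dots> \<le> (exp \<bar>Im z\<bar> + exp \<bar>Im z\<bar>) / 2"
    by (intro divide_right_mono add_mono) auto
  finally show ?thesis by simp
qed

lemma norm_qpow_square:
  "norm (qpow \<tau> ((2 * of_nat n + 1)\<^sup>2 / 8)) = exp (- (pi * Im \<tau> / 4) * (2 * real n + 1)\<^sup>2)"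
proof -
  have "(2 * of_nat n + 1)\<^sup>2 / 8 = complex_of_real ((2 * real n + 1)\<^sup>2 / 8)"
    by simp
  then show ?thesis
    unfolding qpow_def norm_exp_eq_Re by (simp only:) simp
qed

lemma norm_theta1_term_le:
  assumes "\<bar>Im z\<bar> \<le> R"
  shows "norm (theta1_term \<tau> n z) \<le> exp (- (pi * Im \<tau> / 4) * (2 * real n + 1)\<^sup>2) * exp ((2 * real n + 1) * R)"
proof -
  have "norm (sin ((2 * of_nat n + 1) * z)) \<le> exp \<bar>Im ((2 * of_nat n + 1) * z)\<bar>"
    by (rule norm_sin_le_exp)
  also have "Im ((2 * of_nat n + 1) * z) = (2 * real n + 1) * Im z"
    by simp
  also have "exp \<bar>(2 * real n + 1) * Im z\<bar> \<le> exp ((2 * real n + 1) * R)"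
    using assms by (simp add: abs_mult mult_left_mono)
  finally show ?thesis
    unfolding theta1_term_def norm_mult norm_qpow_square by (simp add: norm_power)
qed

text \<open>Completing the square absorbs the linear exponent into a constant and leaves a geometric
  series.\<close>

lemma summable_gaussian:
  assumes "a > 0"
  shows "summable (\<lambda>n. exp (- a * (2 * real n + 1)\<^sup>2) * exp ((2 * real n + 1) * R))"
proof (rule summable_comparison_test')
  have "summable (\<lambda>n. exp (- real n))"
    using summable_geometric[of "exp (-1 :: real)"] by (simp flip: exp_of_nat_mult)
  then show "summable (\<lambda>n. exp ((R + 1)\<^sup>2 / (4 * a)) * exp (- real n))"
    by (rule summable_mult)
  fix n
  \<comment> \<open>Using \<open>R + 1\<close> instead of \<open>R\<close> spares a factor
    \<open>exp (- (2 * real n + 1))\<close>, which is at most \<open>exp (- real n)\<close>.\<close>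
  have "0 \<le> (2 * a * (2 * real n + 1) - (R + 1))\<^sup>2 / (4 * a)"
    using assms by simp
  also have "\<dots> = a * (2 * real n + 1)\<^sup>2 - (2 * real n + 1) * (R + 1) + (R + 1)\<^sup>2 / (4 * a)"
    using assms by (simp add: field_simps power2_eq_square)
  finally have "- a * (2 * real n + 1)\<^sup>2 + (2 * real n + 1) * R \<le> (R + 1)\<^sup>2 / (4 * a) - real n"
    by (simp add: algebra_simps)
  then show "norm (exp (- a * (2 * real n + 1)\<^sup>2) * exp ((2 * real n + 1) * R)) \<le>
      exp ((R + 1)\<^sup>2 / (4 * a)) * exp (- real n)"
    by (simp flip: exp_add)
qed

lemma theta1_uniform_limit:
  assumes "Im \<tau> > 0"
  shows "uniform_limit {z. \<bar>Im z\<bar> \<le> R} (\<lambda>N z. \<Sum>n<N. theta1_term \<tau> n z) (\<lambda>z. \<Sum>n. theta1_term \<tau> n z) sequentially"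
  by (rule Weierstrass_m_test[OF norm_theta1_term_le summable_gaussian]) (use assms in auto)

lemma summable_theta1_term: "Im \<tau> > 0 \<Longrightarrow> summable (\<lambda>n. theta1_term \<tau> n z)"
  by (rule summable_comparison_test'[OF summable_gaussian norm_theta1_term_le[OF order_refl]]) simp

lemma theta1_term_holomorphic: "theta1_term \<tau> n holomorphic_on A"
  unfolding theta1_term_def by (intro holomorphic_intros)

lemma jacobi_theta1_holomorphic:
  assumes "Im \<tau> > 0"
  shows "(\<lambda>z. jacobi_theta1 z \<tau>) holomorphic_on UNIV"
proof -
  have "(\<lambda>z. \<Sum>n. theta1_term \<tau> n z) holomorphic_on UNIV"
  proof (rule holomorphic_uniform_sequence)
    show "(\<lambda>z. \<Sum>n<N. theta1_term \<tau> n z) holomorphic_on UNIV" for N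
      by (intro holomorphic_intros theta1_term_holomorphic)
    fix x :: complex
    have "\<bar>Im z\<bar> \<le> \<bar>Im x\<bar> + 1" if "z \<in> cball x 1" for z
      using that abs_Im_le_cmod[of "x - z"] by (auto simp: dist_norm)
    then have "uniform_limit (cball x 1) (\<lambda>N z. \<Sum>n<N. theta1_term \<tau> n z) (\<lambda>z. \<Sum>n. theta1_term \<tau> n z) sequentially"
      by (intro uniform_limit_on_subset[OF theta1_uniform_limit[OF assms, of "\<bar>Im x\<bar> + 1"]]) auto
    then show "\<exists>d>0. cball x d \<subseteq> UNIV \<and>
        uniform_limit (cball x d) (\<lambda>N z. \<Sum>n<N. theta1_term \<tau> n z) (\<lambda>z. \<Sum>n. theta1_term \<tau> n z) sequentially"
      by (intro exI[of _ 1]) auto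
  qed auto
  then show ?thesis
    unfolding jacobi_theta1_eq_suminf by (intro holomorphic_intros)
qed

section \<open>Parity and translation laws of the theta function\<close>

lemma jacobi_theta1_minus:
  assumes "Im \<tau> > 0"
  shows "jacobi_theta1 (- z) \<tau> = - jacobi_theta1 z \<tau>"
proof -
  have "theta1_term \<tau> n (- z) = - theta1_term \<tau> n z" for n
    by (simp add: theta1_term_def)
  then show ?thesis
    by (simp add: jacobi_theta1_eq_suminf suminf_minus summable_theta1_term assms)
qed

lemma jacobi_theta1_add_pi:
  assumes "Im \<tau> > 0"
  shows "jacobi_theta1 (z + of_real pi) \<tau> = - jacobi_theta1 z \<tau>"
proof -
  have sin_add_npi: "sin (w + of_nat m * of_real pi) = (-1) ^ m * sin w" for m :: nat and w :: complex
  proof (induction m)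
    case (Suc m)
    have "sin (w + of_nat (Suc m) * of_real pi) = sin ((w + of_nat m * of_real pi) + of_real pi)"
      by (simp add: algebra_simps)
    also have "\<dots> = - sin (w + of_nat m * of_real pi)"
      by (simp only: sin_add[of "w + of_nat m * of_real pi" "of_real pi"] sin_of_real cos_of_real) simp
    finally show ?case using Suc by simp
  qed simp
  have "sin ((2 * of_nat n + 1) * (z + of_real pi)) = - sin ((2 * of_nat n + 1) * z)" for n
    using sin_add_npi[of "(2 * of_nat n + 1) * z" "2 * n + 1"] by (simp add: distrib_left add.commute)
  then have "theta1_term \<tau> n (z + of_real pi) = - theta1_term \<tau> n z" for n
    by (simp add: theta1_term_def)
  then show ?thesis
    by (simp add: jacobi_theta1_eq_suminf suminf_minus summable_theta1_term assms)
qed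

text \<open>Split each sine into exponentials. The translation moves the index of the two resulting
  series by one in opposite directions; the boundary term lost by one is gained by the other, so
  their difference is just multiplied by \<open>k\<close>.\<close>

lemma jacobi_theta1_add_pi_tau:
  assumes \<tau>: "Im \<tau> > 0"
  shows "jacobi_theta1 (z + of_real pi * \<tau>) \<tau> = - exp (- (\<i> * of_real pi * \<tau>)) * exp (- (2 * \<i> * z)) * jacobi_theta1 z \<tau>"
proof -
  define c where "c = of_real pi * \<tau>"
  define k where "k = - exp (- (\<i> * c)) * exp (- (2 * \<i> * z))"
  define u where "u n w = (-1) ^ n * qpow \<tau> ((2 * of_nat n + 1)\<^sup>2 / 8) * exp (\<i> * ((2 * of_nat n + 1) * w))" for n w
  have theta_eq: "theta1_term \<tau> n w = (u n w - u n (- w)) / (2 * \<i>)" for n w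
    by (simp add: theta1_term_def u_def sin_exp_eq algebra_simps)
  have norm_u: "norm (u n w) = exp (- (pi * Im \<tau> / 4) * (2 * real n + 1)\<^sup>2) * exp ((2 * real n + 1) * (- Im w))" for n w
    unfolding u_def norm_mult norm_qpow_square by (simp add: norm_power)
  have sum_u: "summable (\<lambda>n. u n w)" for w
    by (rule summable_norm_cancel, unfold norm_u, rule summable_gaussian) (use \<tau> in simp)
  have theta: "jacobi_theta1 w \<tau> = ((\<Sum>n. u n w) - (\<Sum>n. u n (- w))) / \<i>" for w
  proof -
    have "(\<lambda>n. theta1_term \<tau> n w) sums (((\<Sum>n. u n w) - (\<Sum>n. u n (- w))) / (2 * \<i>))"
      unfolding theta_eq by (intro sums_divide sums_diff summable_sums sum_u)
    then show ?thesis by (simp add: jacobi_theta1_eq_suminf sums_iff)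
  qed
  \<comment> \<open>The exponents of q for indices \<open>Suc n\<close> and \<open>n\<close> differ
    by \<open>n + 1\<close>, which matches the translation by \<open>c\<close>; the alternating sign
    goes into \<open>k\<close>.\<close>
  have up: "u n (z + c) = k * u (Suc n) z" for n
    by (simp add: u_def k_def qpow_def c_def flip: exp_add) (simp add: field_simps power2_eq_square)
  have down: "u (Suc n) (- (z + c)) = k * u n (- z)" for n
    by (simp add: u_def k_def qpow_def c_def flip: exp_add) (simp add: field_simps power2_eq_square)
  \<comment> \<open>Index 0 has no predecessor; its value is minus the term that drops out of the
    first series.\<close>
  have down0: "u 0 (- (z + c)) = - (k * u 0 z)"
    by (simp add: u_def k_def qpow_def c_def flip: exp_add) (rule arg_cong[of _ _ exp], simp add: field_simps power2_eq_square)
  have "(\<Sum>n. u n (z + c)) = k * ((\<Sum>n. u n z) - u 0 z)"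
    using suminf_mult[of "\<lambda>n. u (Suc n) z" k] suminf_split_head[OF sum_u[of z]]
      summable_Suc_iff[of "\<lambda>n. u n z"] sum_u[of z]
    by (simp add: up)
  moreover have "(\<Sum>n. u n (- (z + c))) = k * (\<Sum>n. u n (- z)) - k * u 0 z"
    using suminf_split_head[OF sum_u[of "- (z + c)"]] sum_u[of "- z"] down0
    by (simp only: down suminf_mult) simp
  ultimately have "(\<Sum>n. u n (z + c)) - (\<Sum>n. u n (- (z + c))) = k * ((\<Sum>n. u n z) - (\<Sum>n. u n (- z)))"
    by (simp only: right_diff_distrib) simp
  then have "jacobi_theta1 (z + c) \<tau> = k * jacobi_theta1 z \<tau>"
    unfolding theta by simp
  then show ?thesis by (simp add: k_def c_def mult.assoc)
qed

text \<open>A vanishing series would have zero Fourier coefficients, yet after a shift of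
  frequencies its leading term has a nonzero constant coefficient.\<close>

lemma jacobi_theta1_not_identically_0:
  assumes \<tau>: "Im \<tau> > 0"
  shows "\<exists>z. jacobi_theta1 z \<tau> \<noteq> 0"
proof (rule ccontr)
  assume "\<not> ?thesis"
  then have zero: "(\<Sum>n. theta1_term \<tau> n z) = 0" for z
    by (simp add: jacobi_theta1_eq_suminf)
  \<comment> \<open>The odd frequencies of the sines become even after multiplication by
    \<open>exp (- (\<i> * z))\<close>, so each term has period pi.\<close>
  define t where "t n z = theta1_term \<tau> n z * exp (- (\<i> * z))" for n z
  define d where "d n = (-1) ^ n * qpow \<tau> ((2 * of_nat n + 1)\<^sup>2 / 8) / (2 * \<i>)" for n
  have t_eq: "t n z = d n * exp (2 * of_int (int n) * \<i> * z) + (- d n) * exp (2 * of_int (- int n - 1) * \<i> * z)" for n z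
  proof -
    have e1: "exp (2 * of_int (int n) * \<i> * z) = exp (\<i> * ((2 * of_nat n + 1) * z)) * exp (- (\<i> * z))"
      and e2: "exp (2 * of_int (- int n - 1) * \<i> * z) = exp (- (\<i> * ((2 * of_nat n + 1) * z))) * exp (- (\<i> * z))"
      unfolding mult_exp_exp by (rule arg_cong[where f = exp], simp add: algebra_simps)+
    have "s * ((a - b) / (2 * \<i>)) * e = s / (2 * \<i>) * (a * e) + (- (s / (2 * \<i>))) * (b * e)" for s a b e :: complex
      by (simp add: field_simps)
    then show ?thesis
      unfolding e1 e2 t_def d_def theta1_term_def sin_exp_eq by (simp only:)
  qed
  have t_hol: "t n holomorphic_on UNIV" for n
    unfolding t_def by (intro holomorphic_intros theta1_term_holomorphic)
  have e_hol: "(\<lambda>z. exp (2 * of_int m * \<i> * z)) holomorphic_on UNIV" for m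
    by (intro holomorphic_intros)
  \<comment> \<open>The indices in term \<open>n\<close> are \<open>int n\<close> and
    \<open>- int n - 1\<close>; only the first can be 0, and only for \<open>n = 0\<close>.\<close>
  have coeff_t: "fourier_coeff 0 (t n) = (if n = 0 then d 0 * of_real pi else 0)" for n
  proof -
    have "fourier_coeff 0 (t n) = fourier_coeff 0
        (\<lambda>z. d n * exp (2 * of_int (int n) * \<i> * z) + (- d n) * exp (2 * of_int (- int n - 1) * \<i> * z))"
      by (simp only: t_eq[abs_def])
    also have "\<dots> = d n * fourier_coeff 0 (\<lambda>z. exp (2 * of_int (int n) * \<i> * z)) +
        (- d n) * fourier_coeff 0 (\<lambda>z. exp (2 * of_int (- int n - 1) * \<i> * z))"
      by (simp only: fourier_coeff_add fourier_coeff_cmult holomorphic_on_mult holomorphic_on_const e_hol)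
    also have "\<dots> = (if n = 0 then d 0 * of_real pi else 0)"
      unfolding fourier_coeff_exp by simp
    finally show ?thesis .
  qed
  \<comment> \<open>The upper limit \<open>Suc N\<close> guarantees that term 0 is always
    included.\<close>
  have coeff_sum: "fourier_coeff 0 (\<lambda>z. \<Sum>n<Suc N. t n z) = d 0 * of_real pi" for N
  proof (induction N)
    case (Suc N)
    have "fourier_coeff 0 (\<lambda>z. (\<Sum>n<Suc N. t n z) + t (Suc N) z) = d 0 * of_real pi"
      by (subst fourier_coeff_add) (intro holomorphic_intros t_hol | simp add: Suc coeff_t del: sum.lessThan_Suc)+
    then show ?case by simp
  qed (simp add: coeff_t)
  \<comment> \<open>Uniform convergence on the real line lets the limit pass through the integral,
    so these constant coefficients tend to 0.\<close>
  have "uniform_limit {z. Im z = 0} (\<lambda>N z. \<Sum>n<N. t n z) (\<lambda>z. \<Sum>n. t n z) sequentially"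
  proof (rule Weierstrass_m_test[OF _ summable_gaussian])
    show "norm (t n z) \<le> exp (- (pi * Im \<tau> / 4) * (2 * real n + 1)\<^sup>2) * exp ((2 * real n + 1) * 0)"
      if "z \<in> {z. Im z = 0}" for n z
      using norm_theta1_term_le[of z 0 \<tau> n] that by (simp add: t_def norm_mult)
  qed (use \<tau> in simp)
  also have "(\<lambda>z. \<Sum>n. t n z) = (\<lambda>z. 0)"
    using suminf_mult2[OF summable_theta1_term[OF \<tau>]] by (simp add: t_def zero)
  finally have "uniform_limit (path_image (linepath 0 (of_real pi))) (\<lambda>N z. \<Sum>n<N. t n z) (\<lambda>z. 0) sequentially"
    by (rule uniform_limit_on_subset) (auto simp: closed_segment_def)
  then have "(\<lambda>N. contour_integral (linepath 0 (of_real pi)) (\<lambda>z. \<Sum>n<N. t n z)) \<longlonglongrightarrow>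
      contour_integral (linepath 0 (of_real pi)) (\<lambda>z. 0)"
    by (intro contour_integral_uniform_limit(2)[where B = pi] always_eventually allI
        entire_integrable_linepath holomorphic_intros t_hol) auto
  then have "(\<lambda>N. fourier_coeff 0 (\<lambda>z. \<Sum>n<N. t n z)) \<longlonglongrightarrow> 0"
    by (simp add: fourier_coeff_def)
  then have "(\<lambda>N. fourier_coeff 0 (\<lambda>z. \<Sum>n<Suc N. t n z)) \<longlonglongrightarrow> 0"
    by (rule LIMSEQ_Suc)
  then have "d 0 * of_real pi = 0"
    unfolding coeff_sum by (simp add: LIMSEQ_const_iff)
  then show False by (simp add: d_def qpow_def)
qed

text \<open>Under translation by pi the two signs cancel. Under translation by
  \<open>of_real pi * \<tau>\<close> the multipliers of the factors combine so that \<open>y\<close>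
  drops out, which puts the products for all \<open>y\<close> in the same space.\<close>

lemma theta1_product_in_theta_space:
  assumes \<tau>: "Im \<tau> > 0"
  shows "(\<lambda>x. jacobi_theta1 (x + y + \<alpha>) \<tau> * jacobi_theta1 (x - y) \<tau>)
    \<in> theta_space (exp (2 * of_real pi * \<i> * \<tau>) * exp (2 * \<i> * \<alpha>)) \<tau>"
  unfolding theta_space_def mem_Collect_eq
proof (intro conjI allI)
  have "(\<lambda>x. jacobi_theta1 (x + c) \<tau>) holomorphic_on UNIV" for c
    by (rule holomorphic_on_compose[of "\<lambda>x. x + c" UNIV "\<lambda>z. jacobi_theta1 z \<tau>", unfolded o_def])
       (auto intro!: holomorphic_intros holomorphic_on_subset[OF jacobi_theta1_holomorphic[OF \<tau>]])
  from holomorphic_on_mult[OF this[of "y + \<alpha>"] this[of "- y"]]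
  show "(\<lambda>x. jacobi_theta1 (x + y + \<alpha>) \<tau> * jacobi_theta1 (x - y) \<tau>) holomorphic_on UNIV"
    by (simp add: add.assoc)
  fix x
  show "jacobi_theta1 (x + of_real pi + y + \<alpha>) \<tau> * jacobi_theta1 (x + of_real pi - y) \<tau> =
      jacobi_theta1 (x + y + \<alpha>) \<tau> * jacobi_theta1 (x - y) \<tau>"
    using jacobi_theta1_add_pi[OF \<tau>, of "x + y + \<alpha>"] jacobi_theta1_add_pi[OF \<tau>, of "x - y"]
    by (simp add: algebra_simps)
  define c where "c = of_real pi * \<tau>"
  define k where "k z = - exp (- (\<i> * c)) * exp (- (2 * \<i> * z))" for z
  have shift: "jacobi_theta1 (z + c) \<tau> = k z * jacobi_theta1 z \<tau>" for z
    using jacobi_theta1_add_pi_tau[OF \<tau>, of z] by (simp add: c_def k_def mult.assoc)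
  have k: "exp (2 * \<i> * c) * exp (2 * \<i> * \<alpha>) * exp (4 * \<i> * x) * (k (x + y + \<alpha>) * k (x - y)) = 1"
    by (simp add: k_def flip: exp_add) (simp add: algebra_simps)
  have "exp (2 * \<i> * c) * exp (2 * \<i> * \<alpha>) * exp (4 * \<i> * x) *
      (jacobi_theta1 (x + y + \<alpha> + c) \<tau> * jacobi_theta1 (x - y + c) \<tau>) =
      (exp (2 * \<i> * c) * exp (2 * \<i> * \<alpha>) * exp (4 * \<i> * x) * (k (x + y + \<alpha>) * k (x - y))) *
      (jacobi_theta1 (x + y + \<alpha>) \<tau> * jacobi_theta1 (x - y) \<tau>)"
    unfolding shift by (simp only: mult_ac)
  also have "\<dots> = jacobi_theta1 (x + y + \<alpha>) \<tau> * jacobi_theta1 (x - y) \<tau>"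
    unfolding k by simp
  finally show "jacobi_theta1 (x + y + \<alpha>) \<tau> * jacobi_theta1 (x - y) \<tau> =
      exp (2 * of_real pi * \<i> * \<tau>) * exp (2 * \<i> * \<alpha>) * exp (4 * \<i> * x) *
      (jacobi_theta1 (x + of_real pi * \<tau> + y + \<alpha>) \<tau> * jacobi_theta1 (x + of_real pi * \<tau> - y) \<tau>)"
    by (simp add: c_def algebra_simps)
qed

section \<open>The identity\<close>

theorem theorem4p1:
  fixes \<tau> q \<alpha> :: complex and F G :: "complex \<Rightarrow> complex"
  assumes "Im \<tau> > 0"
    and "q = exp (2 * of_real pi * \<i> * \<tau>)"
    and "F holomorphic_on UNIV" and "G holomorphic_on UNIV"
    and "\<And>z. F z = F (z + of_real pi)"
    and "\<And>z. F (z + of_real pi) = q * exp (2 * \<i> * \<alpha> + 4 * \<i> * z) * F (z + of_real pi * \<tau>)"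
    and "\<And>z. G z = G (z + of_real pi)"
    and "\<And>z. G (z + of_real pi) = q * exp (2 * \<i> * \<alpha> + 4 * \<i> * z) * G (z + of_real pi * \<tau>)"
  shows "\<exists>C. \<forall>x y. G x * G y \<noteq> 0 \<longrightarrow>
           F x / G x - F y / G y =
             C * (jacobi_theta1 (x + y + \<alpha>) \<tau> * jacobi_theta1 (x - y) \<tau> / (G x * G y))"
proof -
  define \<kappa> where "\<kappa> = q * exp (2 * \<i> * \<alpha>)"
  have \<kappa>: "\<kappa> \<noteq> 0" by (simp add: \<kappa>_def assms(2))
  have F: "F \<in> theta_space \<kappa> \<tau>"
    unfolding theta_space_def mem_Collect_eq
  proof (intro conjI allI)
    show "F z = \<kappa> * exp (4 * \<i> * z) * F (z + of_real pi * \<tau>)" for z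
      using trans[OF assms(5)[of z] assms(6)[of z]] by (simp only: \<kappa>_def exp_add mult.assoc)
  qed (rule assms(3) assms(5)[symmetric])+
  have G: "G \<in> theta_space \<kappa> \<tau>"
    unfolding theta_space_def mem_Collect_eq
  proof (intro conjI allI)
    show "G z = \<kappa> * exp (4 * \<i> * z) * G (z + of_real pi * \<tau>)" for z
      using trans[OF assms(7)[of z] assms(8)[of z]] by (simp only: \<kappa>_def exp_add mult.assoc)
  qed (rule assms(4) assms(7)[symmetric])+
  define T where "T x y = jacobi_theta1 (x + y + \<alpha>) \<tau> * jacobi_theta1 (x - y) \<tau>" for x y
  define D where "D x y = F x * G y - F y * G x" for x y
  have T: "(\<lambda>x. T x y) \<in> theta_space \<kappa> \<tau>" for y
    unfolding T_def \<kappa>_def assms(2) by (rule theta1_product_in_theta_space[OF assms(1)])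
  have T_anti: "T x y = - T y x" for x y
  proof -
    have "jacobi_theta1 (x - y) \<tau> = - jacobi_theta1 (y - x) \<tau>"
      using jacobi_theta1_minus[OF assms(1), of "y - x"] by (simp only: minus_diff_eq)
    then show ?thesis
      unfolding T_def add.commute[of y x] by (simp only: mult_minus_right)
  qed
  have D_anti: "D x y = - D y x" for x y
    by (simp add: D_def)
  have cross: "D x z * T y z = D y z * T x z" for x y z
  proof -
    \<comment> \<open>Taking the parameter of the third function as the third point isolates
      \<open>T z z\<close>, which is zero by antisymmetry.\<close>
    have "D x y * T z z + D y z * T x z + D z x * T y z = 0"
      using theta_space_det_zero[OF F G T[of z] \<kappa>, of x y z] by (simp add: D_def)
    moreover have "2 * T z z = 0" using T_anti[of z z] by algebra
    ultimately show ?thesis using D_anti[of z x] by algebra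
  qed
  obtain t where t: "jacobi_theta1 t \<tau> \<noteq> 0"
    using jacobi_theta1_not_identically_0[OF assms(1)] by blast
  \<comment> \<open>Chosen so that both arguments in \<open>T p r\<close> equal \<open>t\<close>,
    making it the square of a nonzero theta value.\<close>
  define r where "r = - \<alpha> / 2"
  define p where "p = t + r"
  have pr: "T p r \<noteq> 0"
    using t by (simp add: T_def p_def r_def)
  define C where "C = D p r / T p r"
  have r: "D x r = C * T x r" for x
    using cross[of x r p] pr by (simp add: C_def field_simps)
  \<comment> \<open>Antisymmetry, \<open>cross\<close> and the known case of second argument
    \<open>r\<close> give the identity multiplied by \<open>T x r\<close>. As a function of
    \<open>x\<close> this factor is nonzero at \<open>p\<close>, so it can be cancelled.\<close>
  have "D x z - C * T x z = 0" for x z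
  proof (rule entire_mult_eq_0[where f = "\<lambda>x. D x z - C * T x z" and g = "\<lambda>x. T x r" and p = p])
    show "(\<lambda>x. D x z - C * T x z) holomorphic_on UNIV"
      unfolding D_def by (intro holomorphic_intros theta_space_holomorphic[OF F] theta_space_holomorphic[OF G]
        theta_space_holomorphic[OF T])
    show "(\<lambda>x. T x r) holomorphic_on UNIV"
      by (rule theta_space_holomorphic[OF T])
    show "(D x z - C * T x z) * T x r = 0" for x
    proof -
      have "D z x * T r x = C * T r x * T z x"
        using cross[of z x r] r[of x] D_anti[of r x] T_anti[of r x] by simp
      then show ?thesis
        using D_anti[of z x] T_anti[of z x] T_anti[of r x] by (simp add: algebra_simps)
    qed
  qed (rule pr)
  then have main: "F x * G y - F y * G x = C * T x y" for x y
    by (simp add: D_def)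
  show ?thesis
  proof (intro exI[of _ C] allI impI)
    fix x y assume "G x * G y \<noteq> 0"
    then have "F x / G x - F y / G y = (F x * G y - F y * G x) / (G x * G y)"
      by (simp add: field_simps)
    then show "F x / G x - F y / G y =
        C * (jacobi_theta1 (x + y + \<alpha>) \<tau> * jacobi_theta1 (x - y) \<tau> / (G x * G y))"
      by (simp add: main T_def)
  qed
qed

end
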